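(* Let $G$ be a locally gyroscopic invariant paratopological gyrogroup whose underlying topological space is regular. Then $G$ is completely regular.
   Context: A gyrogroup is a nonempty set $G$ with a binary operation $\oplus$ such that: (G1) there is $e\in G$ with $e\oplus x=x=x\oplus e$ for all $x$; (G2) each $x\in G$ has an inverse $\ominus x$ with $\ominus x\oplus x=e=x\oplus(\ominus x)$; (G3) for all $x,y\in G$ there is an automorphism $\mathrm{gyr}[x,y]$ of the groupoid $(G,\oplus)$ (a bijection of $G$ preserving $\oplus$) with $x\oplus(y\oplus z)=(x\oplus y)\oplus \mathrm{gyr}[x,y](z)$ for all $z\in G$; (G4) $\mathrm{gyr}[x\oplus y,y]=\mathrm{gyr}[x,y]$ for all $x,y\in G$. (The map $\mathrm{gyr}[x,y]$ is then uniquely determined.) A paratopological gyrogroup is a gyrogroup $G$ with a topology such that $\oplus:G\times G\to G$ is (jointly) continuous, where $G\times G$ carries the product topology. For $V\subseteq G$, $\mathrm{gyr}[a,b]V=\{\mathrm{gyr}[a,b](v):v\in V\}$. A paratopological gyrogroup $G$ is locally gyroscopic invariant if there are a local base $\mathscr{B}$ at the identity $e$ and an open neighborhood $U$ of $e$ such that $\mathrm{gyr}[a,b]V\subseteq V$ for every $V\in\mathscr{B}$ and all $a,b\in U$. No separation axiom is assumed unless stated. A space $X$ is regular if for every $x\in X$ and every open $U\ni x$ there is a neighborhood $V$ of $x$ with $\overline{V}\subseteq U$. A space $X$ is completely regular if for every $x\in X$ and every open $U\ni x$ there is a continuous $f:X\to[0,1]$ with $f(x)=0$ and $f^{-1}([0,1))\subseteq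 U$. *)

theory Defs
  imports "HOL-Analysis.Analysis"
begin

text \<open>
  The gyrations are a parameter of the locale; they are determined on \<open>G\<close> by the axioms, see
  \<open>gyr_unique\<close> below. Only the values of \<open>add\<close> and \<open>gyr\<close> on \<open>G\<close> are constrained.
\<close>

locale gyrogroup =
  fixes G :: "'a set"
    and add :: "'a \<Rightarrow> 'a \<Rightarrow> 'a" (infixl "\<oplus>" 65)
    and e :: 'a
    and gyr :: "'a \<Rightarrow> 'a \<Rightarrow> 'a \<Rightarrow> 'a"
  assumes add_closed: "\<lbrakk>x \<in> G; y \<in> G\<rbrakk> \<Longrightarrow> x \<oplus> y \<in> G"
    and e_closed: "e \<in> G"
    and add_e_left: "x \<in> G \<Longrightarrow> e \<oplus> x = x"
    and add_e_right: "x \<in> G \<Longrightarrow> x \<oplus> e = x"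
    and ex_inverse: "x \<in> G \<Longrightarrow> \<exists>y\<in>G. y \<oplus> x = e \<and> x \<oplus> y = e"
    and gyr_bij: "\<lbrakk>x \<in> G; y \<in> G\<rbrakk> \<Longrightarrow> bij_betw (gyr x y) G G"
    and gyr_add: "\<lbrakk>x \<in> G; y \<in> G; u \<in> G; v \<in> G\<rbrakk>
                    \<Longrightarrow> gyr x y (u \<oplus> v) = gyr x y u \<oplus> gyr x y v"
    and gyr_assoc: "\<lbrakk>x \<in> G; y \<in> G; z \<in> G\<rbrakk>
                    \<Longrightarrow> x \<oplus> (y \<oplus> z) = (x \<oplus> y) \<oplus> gyr x y z"
    and gyr_loop: "\<lbrakk>x \<in> G; y \<in> G; z \<in> G\<rbrakk> \<Longrightarrow> gyr (x \<oplus> y) y z = gyr x y z"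
begin

lemma add_left_cancel:
  assumes x: "x \<in> G" and y: "y \<in> G" and z: "z \<in> G" and eq: "x \<oplus> y = x \<oplus> z"
  shows "y = z"
proof -
  obtain x' where x': "x' \<in> G" "x' \<oplus> x = e"
    using ex_inverse x by blast
  have *: "x' \<oplus> (x \<oplus> w) = gyr x' x w" if w: "w \<in> G" for w
  proof -
    have "gyr x' x w \<in> G"
      using gyr_bij[OF x'(1) x] w by (rule bij_betw_apply)
    then show ?thesis
      using gyr_assoc[OF x'(1) x w] x'(2) add_e_left by simp
  qed
  have "gyr x' x y = gyr x' x z"
    using *[OF y] *[OF z] eq by simp
  then show ?thesis
    using gyr_bij[OF x'(1) x] y z by (meson bij_betw_imp_inj_on inj_onD)
qed

lemma gyr_unique:
  assumes x: "x \<in> G" and y: "y \<in> G" and z: "z \<in> G"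
    and \<phi>: "\<phi> z \<in> G" "x \<oplus> (y \<oplus> z) = (x \<oplus> y) \<oplus> \<phi> z"
  shows "\<phi> z = gyr x y z"
proof (rule add_left_cancel)
  show "x \<oplus> y \<in> G" using x y by (rule add_closed)
  show "gyr x y z \<in> G" using gyr_bij[OF x y] z by (rule bij_betw_apply)
  show "(x \<oplus> y) \<oplus> \<phi> z = (x \<oplus> y) \<oplus> gyr x y z" using \<phi>(2) gyr_assoc[OF x y z] by simp
qed (rule \<phi>(1))

end

text \<open>The underlying set of the gyrogroup is the underlying set of the space.\<close>

locale paratopological_gyrogroup = gyrogroup "topspace X" add e gyr
  for X :: "'a topology"
    and add :: "'a \<Rightarrow> 'a \<Rightarrow> 'a" (infixl "\<oplus>" 65)
    and e :: 'a
    and gyr :: "'a \<Rightarrow> 'a \<Rightarrow> 'a \<Rightarrow> 'a" +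
  assumes continuous_add: "continuous_map (prod_topology X X) X (\<lambda>(x, y). x \<oplus> y)"

definition local_base_at :: "'a topology \<Rightarrow> 'a \<Rightarrow> 'a set set \<Rightarrow> bool" where
  "local_base_at X x \<B> \<longleftrightarrow>
     (\<forall>V\<in>\<B>. openin X V \<and> x \<in> V) \<and>
     (\<forall>W. openin X W \<and> x \<in> W \<longrightarrow> (\<exists>V\<in>\<B>. V \<subseteq> W))"

definition locally_gyroscopic_invariant ::
    "'a topology \<Rightarrow> 'a \<Rightarrow> ('a \<Rightarrow> 'a \<Rightarrow> 'a \<Rightarrow> 'a) \<Rightarrow> bool" where
  "locally_gyroscopic_invariant X e gyr \<longleftrightarrow>
     (\<exists>\<B> U. local_base_at X e \<B> \<and> openin X U \<and> e \<in> U \<and>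
        (\<forall>V\<in>\<B>. \<forall>a\<in>U. \<forall>b\<in>U. gyr a b ` V \<subseteq> V))"

end

theory Submission
  imports Defs
begin

text \<open>
  A gyrogroup is homogeneous under left translations, so it suffices to separate \<open>e\<close> from a closed
  set. Continuity of right translations gives the inclusion
  \<open>cl A \<subseteq> cl A \<oplus> V \<subseteq> cl (A \<oplus> V)\<close>, whose middle term is open; thus closures of \<open>V\<close>-enlargements
  provide, without normality, the nested families needed in Urysohn's construction. Local gyroscopic
  invariance together with \<open>(a \<oplus> b) \<oplus> c = a \<oplus> (b \<oplus> gyr b (a \<oplus> b) c)\<close> makes two successive
  enlargements near \<open>e\<close> by \<open>V\<close> fit into one enlargement by \<open>V \<oplus> V\<close>, which is what indexing the
  family by dyadic rationals requires. Regularity keeps the closures inside the given neighbourhood.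
\<close>

section \<open>Urysohn functions from dyadic families\<close>

lemma nested_dyadic_refine:
  fixes W :: "nat \<Rightarrow> nat \<Rightarrow> 'a set"
  assumes "\<And>n m. W (Suc n) (2 * m) = W n m"
  shows "W (n + k) (m * 2 ^ k) = W n m"
proof (induction k)
  case (Suc k)
  have "m * 2 ^ Suc k = 2 * (m * 2 ^ k)" by simp
  then show ?case using assms[of "n + k" "m * 2 ^ k"] Suc by (metis add_Suc_right)
qed simp

text \<open>Over the common denominator \<open>2 ^ (n + n')\<close> the inequality compares two
  numerators, and the inclusion becomes a chain of single steps. The bound on \<open>m'\<close>
  keeps this chain in the range where \<open>step\<close> applies.\<close>

lemma nested_dyadic_mono:
  fixes W :: "nat \<Rightarrow> nat \<Rightarrow> 'a set"
  assumes refine: "\<And>n m. W (Suc n) (2 * m) = W n m"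
    and step: "\<And>n m. m < 2 ^ n \<Longrightarrow> W n m \<subseteq> W n (Suc m)"
    and le: "real m / 2 ^ n \<le> real m' / 2 ^ n'" and m': "m' \<le> 2 ^ n'"
  shows "W n m \<subseteq> W n' m'"
proof -
  have mono: "W k i \<subseteq> W k j" if "i \<le> j" "j \<le> 2 ^ k" for k i j
    using that
  proof (induction j rule: dec_induct)
    case (step j)
    then show ?case using assms(2)[of j k] by (meson Suc_le_lessD less_imp_le order_trans)
  qed simp
  have "real (m * 2 ^ n') \<le> real (m' * 2 ^ n)"
    using le by (simp add: field_simps)
  then have "m * 2 ^ n' \<le> m' * 2 ^ n" by (simp only: of_nat_le_iff)
  moreover have "m' * 2 ^ n \<le> 2 ^ (n + n')" using m' by (simp add: power_add)
  ultimately have "W (n + n') (m * 2 ^ n') \<subseteq> W (n + n') (m' * 2 ^ n)" by (rule mono)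
  then show ?thesis
    using nested_dyadic_refine[of W n n' m, OF refine] nested_dyadic_refine[of W n' n m', OF refine]
    by (simp add: add.commute)
qed

text \<open>The value at \<open>x\<close> is the infimum of the dyadic numbers
  \<open>m / 2 ^ n\<close> for which the closure of \<open>W n m\<close> contains \<open>x\<close>.
  Sublevel sets are open because of the open sets interposed by \<open>nest\<close>; superlevel sets
  are open because the closures are closed.\<close>

lemma Urysohn_function_of_dyadic_family:
  fixes W :: "nat \<Rightarrow> nat \<Rightarrow> 'a set"
  assumes refine: "\<And>n m. W (Suc n) (2 * m) = W n m"
    and step: "\<And>n m. m < 2 ^ n \<Longrightarrow> W n m \<subseteq> W n (Suc m)"
    and nest: "\<And>n m. m < 2 ^ n \<Longrightarrow>
      \<exists>N. openin X N \<and> X closure_of W n m \<subseteq> N \<and> N \<subseteq> X closure_of W n (Suc m)"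
  obtains f where "continuous_map X (top_of_set {0..1::real}) f"
    "\<And>x. x \<in> X closure_of W 0 0 \<Longrightarrow> f x = 0"
    "\<And>x. x \<notin> X closure_of W 0 1 \<Longrightarrow> f x = 1"
proof -
  \<comment> \<open>The inserted 1 is the value at points outside all the closures, and it keeps the
    infimum from being taken over the empty set.\<close>
  define D where "D x = insert 1 {real m / 2 ^ n |n m. m \<le> 2 ^ n \<and> x \<in> X closure_of W n m}" for x
  define f where "f x = Inf (D x)" for x
  have D01: "0 \<le> d \<and> d \<le> 1" if "d \<in> D x" for d x
  proof -
    have "0 \<le> real m / 2 ^ n \<and> real m / 2 ^ n \<le> 1" if "m \<le> 2 ^ n" for n m
      using of_nat_mono[OF that, where 'a = real] by simp
    then show ?thesis using that by (auto simp: D_def)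
  qed
  have bdd: "bdd_below (D x)" for x
    using D01 by (meson bdd_belowI)
  have ne: "D x \<noteq> {}" for x by (simp add: D_def)
  have f01: "0 \<le> f x" "f x \<le> 1" for x
  proof -
    show "0 \<le> f x" unfolding f_def using D01 by (meson cInf_greatest ne)
    show "f x \<le> 1" unfolding f_def by (rule cInf_lower[OF _ bdd]) (simp add: D_def)
  qed
  have le: "f x \<le> real m / 2 ^ n" if "m \<le> 2 ^ n" "x \<in> X closure_of W n m" for x n m
    unfolding f_def by (rule cInf_lower[OF _ bdd]) (use that in \<open>auto simp: D_def\<close>)
  have mono: "X closure_of W n m \<subseteq> X closure_of W n' m'"
    if "real m / 2 ^ n \<le> real m' / 2 ^ n'" "m' \<le> 2 ^ n'" for n m n' m'
    by (rule closure_of_mono) (rule nested_dyadic_mono[of W, OF refine step that])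
  have ge: "real m / 2 ^ n \<le> f x" if "m \<le> 2 ^ n" "x \<notin> X closure_of W n m" for x n m
    unfolding f_def
  proof (rule cInf_greatest[OF ne])
    fix d assume "d \<in> D x"
    then consider "d = 1" | n' m' where "d = real m' / 2 ^ n'" "m' \<le> 2 ^ n'" "x \<in> X closure_of W n' m'"
      by (auto simp: D_def)
    then show "real m / 2 ^ n \<le> d"
    proof cases
      case 1
      then show ?thesis using that by (simp add: divide_simps)
    next
      case 2
      then show ?thesis using mono[of m' n' m n] that by (meson linear subsetD)
    qed
  qed
  have lower: "openin X {x \<in> topspace X. f x < a}" for a
  proof (cases "a \<le> 1")
    case False
    then have "{x \<in> topspace X. f x < a} = topspace X"
      using f01(2) by (smt (verit) Collect_cong Collect_mem_eq)
    then show ?thesis by simp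
  next
    case True
    show ?thesis
    proof (subst openin_subopen, clarify)
      fix x assume x: "x \<in> topspace X" and "f x < a"
      then obtain d where d: "d \<in> D x" "d < a"
        unfolding f_def using cInf_less_iff[OF ne bdd] by blast
      \<comment> \<open>Since \<open>d < a \<le> 1\<close>, \<open>d\<close> is not the inserted
        default value. The grid is then refined until one more step beyond \<open>d\<close> still
        stays below \<open>a\<close>; the open set between these two neighbouring closures is the
        required neighbourhood.\<close>
      with True obtain n m where m: "d = real m / 2 ^ n" "m \<le> 2 ^ n" "x \<in> X closure_of W n m"
        by (auto simp: D_def)
      obtain k where k: "(1/2) ^ k < a - d"
        using real_arch_pow_inv[of "a - d" "1/2"] d by auto
      let ?m = "m * 2 ^ k"
      have sum: "real (Suc ?m) / 2 ^ (n + k) < a"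
      proof -
        have "real (Suc ?m) / 2 ^ (n + k) = d + (1/2) ^ (n + k)"
          by (simp add: m(1) field_simps power_add)
        also have "(1/2::real) ^ (n + k) \<le> (1/2) ^ k" by (rule power_decreasing) auto
        finally show ?thesis using k by linarith
      qed
      then have "real (Suc ?m) < 2 ^ (n + k)"
        using True by (smt (verit) divide_less_eq_1_pos zero_less_power)
      then have lt: "Suc ?m < 2 ^ (n + k)" by (metis of_nat_less_iff of_nat_numeral of_nat_power)
      then obtain N where N: "openin X N" "X closure_of W (n + k) ?m \<subseteq> N"
        "N \<subseteq> X closure_of W (n + k) (Suc ?m)"
        using nest[of ?m "n + k"] by auto
      have "x \<in> N"
        using N(2) m(3) nested_dyadic_refine[of W n k m, OF refine] by auto
      moreover have "N \<subseteq> {x \<in> topspace X. f x < a}"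
        using N(1,3) le[of "Suc ?m" "n + k"] lt sum openin_subset[OF N(1)] by fastforce
      ultimately show "\<exists>T. openin X T \<and> x \<in> T \<and> T \<subseteq> {x \<in> topspace X. f x < a}"
        using N(1) by blast
    qed
  qed
  have upper: "openin X {x \<in> topspace X. f x > a}" for a
  proof (cases "a < 0")
    case True
    then have "{x \<in> topspace X. f x > a} = topspace X"
      using f01(1) by (smt (verit) Collect_cong Collect_mem_eq)
    then show ?thesis by simp
  next
    case False
    show ?thesis
    proof (subst openin_subopen, clarify)
      fix x assume x: "x \<in> topspace X" and "a < f x"
      then obtain n where n: "(1/2) ^ n < f x - a"
        using real_arch_pow_inv[of "f x - a" "1/2"] by auto
      \<comment> \<open>The least grid point strictly above \<open>a\<close>; it exceeds
        \<open>a\<close> by at most \<open>(1/2) ^ n\<close>, hence lies strictly between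
        \<open>a\<close> and \<open>f x\<close>. The neighbourhood of \<open>x\<close> is the
        complement of the closure of \<open>W n m\<close>.\<close>
      define m where "m = Suc (nat \<lfloor>a * 2 ^ n\<rfloor>)"
      have "real m = of_int \<lfloor>a * 2 ^ n\<rfloor> + 1" using False by (simp add: m_def)
      then have m: "a * 2 ^ n < real m" "real m \<le> a * 2 ^ n + 1" by linarith+
      have am: "a < real m / 2 ^ n" using m(1) by (simp add: field_simps)
      have "real m / 2 ^ n \<le> a + (1/2) ^ n" using m(2) by (simp add: field_simps)
      then have mf: "real m / 2 ^ n < f x" using n by linarith
      then have "real m / 2 ^ n < 1" using f01(2)[of x] by linarith
      then have "real m < 2 ^ n" by simp
      then have "m \<le> 2 ^ n" by (metis less_imp_le of_nat_less_iff of_nat_numeral of_nat_power)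
      then have "x \<in> topspace X - X closure_of W n m"
        and "topspace X - X closure_of W n m \<subseteq> {x \<in> topspace X. a < f x}"
        using x le[of m n x] ge[of m n] mf am by fastforce+
      then show "\<exists>T. openin X T \<and> x \<in> T \<and> T \<subseteq> {x \<in> topspace X. a < f x}"
        by (meson closedin_closure_of closedin_def)
    qed
  qed
  have "continuous_map X euclideanreal f"
    unfolding continuous_map_upper_lower_semicontinuous_lt using lower upper by blast
  then have "continuous_map X (top_of_set {0..1}) f"
    using f01 by (auto simp: continuous_map_in_subtopology)
  moreover have "f x = 0" if "x \<in> X closure_of W 0 0" for x
    using le[of 0 0 x] that f01(1)[of x] by simp
  moreover have "f x = 1" if "x \<notin> X closure_of W 0 1" for x
    using ge[of 1 0 x] that f01(2)[of x] by simp
  ultimately show thesis by (rule that)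
qed

section \<open>Translations of gyrogroups\<close>

context gyrogroup
begin

lemma gyr_e_left:
  assumes "x \<in> G" "z \<in> G"
  shows "gyr e x z = z"
  using gyr_unique[of e x z "\<lambda>z. z"] assms by (simp add: add_closed e_closed add_e_left)

text \<open>The loop property turns \<open>gyr x' x\<close> into \<open>gyr e x\<close>, which is
  the identity.\<close>

lemma add_inverse_cancel:
  assumes "x \<in> G" "x' \<in> G" "x' \<oplus> x = e" "z \<in> G"
  shows "x' \<oplus> (x \<oplus> z) = z"
  using gyr_assoc[of x' x z] gyr_loop[of x' x z] gyr_e_left assms by (simp add: add_e_left)

text \<open>Right gyroassociativity. Translating on the left by an inverse \<open>a'\<close> of
  \<open>a\<close> produces \<open>gyr a' (a \<oplus> b)\<close>, and the loop property rewrites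
  this as \<open>gyr b (a \<oplus> b)\<close> because
  \<open>a' \<oplus> (a \<oplus> b) = b\<close>.\<close>

lemma add_assoc_right:
  assumes a: "a \<in> G" and b: "b \<in> G" and c: "c \<in> G"
  shows "(a \<oplus> b) \<oplus> c = a \<oplus> (b \<oplus> gyr b (a \<oplus> b) c)"
proof -
  obtain a' where a': "a' \<in> G" "a' \<oplus> a = e" "a \<oplus> a' = e"
    using ex_inverse a by blast
  have ab: "a \<oplus> b \<in> G" using a b by (rule add_closed)
  have b_eq: "a' \<oplus> (a \<oplus> b) = b" using add_inverse_cancel a a' b by blast
  have "a' \<oplus> ((a \<oplus> b) \<oplus> c) = b \<oplus> gyr a' (a \<oplus> b) c"
    using gyr_assoc[OF a'(1) ab c] b_eq by simp
  also have "gyr a' (a \<oplus> b) c = gyr b (a \<oplus> b) c"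
    using gyr_loop[OF a'(1) ab c] b_eq by simp
  finally have "a \<oplus> (a' \<oplus> ((a \<oplus> b) \<oplus> c)) = a \<oplus> (b \<oplus> gyr b (a \<oplus> b) c)" by simp
  then show ?thesis
    using add_inverse_cancel[OF a'(1) a a'(3)] ab c by (simp add: add_closed)
qed

section \<open>Set sums and the dyadic family\<close>

definition set_add :: "'a set \<Rightarrow> 'a set \<Rightarrow> 'a set" where
  "set_add A B = (\<lambda>(x, y). x \<oplus> y) ` (A \<times> B)"

lemma set_add_mono: "\<lbrakk>A \<subseteq> A'; B \<subseteq> B'\<rbrakk> \<Longrightarrow> set_add A B \<subseteq> set_add A' B'"
  by (auto simp: set_add_def)

lemma subset_set_add: "\<lbrakk>A \<subseteq> G; e \<in> B\<rbrakk> \<Longrightarrow> A \<subseteq> set_add A B"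
  by (force simp: set_add_def add_e_right)

lemma set_add_assoc_subset:
  assumes "A \<subseteq> G" "B \<subseteq> G" "C \<subseteq> G"
    and "\<And>b d. \<lbrakk>b \<in> B; d \<in> set_add A B\<rbrakk> \<Longrightarrow> gyr b d ` C \<subseteq> C"
  shows "set_add (set_add A B) C \<subseteq> set_add A (set_add B C)"
proof
  fix z assume "z \<in> set_add (set_add A B) C"
  then obtain a b c where abc: "a \<in> A" "b \<in> B" "c \<in> C" "z = (a \<oplus> b) \<oplus> c"
    by (auto simp: set_add_def)
  then have "z = a \<oplus> (b \<oplus> gyr b (a \<oplus> b) c)"
    using add_assoc_right assms by blast
  moreover have "gyr b (a \<oplus> b) c \<in> C"
    using assms(4)[of b "a \<oplus> b"] abc by (force simp: set_add_def)
  ultimately show "z \<in> set_add A (set_add B C)"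
    using abc by (auto simp: set_add_def)
qed

text \<open>For \<open>m < 2 ^ n\<close> this is the sum, bracketed to the left, of
  \<open>{e}\<close> and those \<open>V i\<close> for which the binary digit of weight
  \<open>2 ^ (- i)\<close> in \<open>m / 2 ^ n\<close> is 1. The clause for even \<open>m\<close>
  makes the set depend on the fraction alone.\<close>

primrec dyadic_add :: "(nat \<Rightarrow> 'a set) \<Rightarrow> nat \<Rightarrow> nat \<Rightarrow> 'a set" where
  "dyadic_add V 0 m = (if m = 0 then {e} else V 0)"
| "dyadic_add V (Suc n) m =
     (if even m then dyadic_add V n (m div 2) else set_add (dyadic_add V n (m div 2)) (V (Suc n)))"

text \<open>Induction on the level. For even \<open>m\<close> the new set is by definition the old
  one enlarged by \<open>V (Suc n)\<close>. For odd \<open>m\<close> two enlargements by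
  \<open>V (Suc n)\<close> are merged into one by \<open>V n\<close>. Containment in
  \<open>V 0\<close> is carried along because the gyrations in this regrouping need both arguments
  there.\<close>

lemma dyadic_add_step:
  assumes V: "\<And>n. V n \<subseteq> G" "\<And>n. e \<in> V n" "\<And>n. set_add (V (Suc n)) (V (Suc n)) \<subseteq> V n"
    and gyr: "\<And>n a b. \<lbrakk>a \<in> V 0; b \<in> V 0\<rbrakk> \<Longrightarrow> gyr a b ` V n \<subseteq> V n"
    and "m < 2 ^ n"
  shows "dyadic_add V n m \<subseteq> V 0 \<and> set_add (dyadic_add V n m) (V n) \<subseteq> dyadic_add V n (Suc m)
    \<and> dyadic_add V n (Suc m) \<subseteq> V 0"
  using \<open>m < 2 ^ n\<close>
proof (induction n arbitrary: m)
  case 0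
  then show ?case using V(1)[of 0] V(2)[of 0] by (auto simp: set_add_def add_e_left)
next
  case (Suc n)
  define k where "k = m div 2"
  have VS: "V (Suc n) \<subseteq> V n"
    using subset_set_add[OF V(1) V(2), of "Suc n" "Suc n"] V(3)[of n] by blast
  have "V j \<subseteq> V 0" for j
  proof (induction j)
    case (Suc j)
    then show ?case
      using subset_set_add[OF V(1) V(2), of "Suc j" "Suc j"] V(3)[of j] by blast
  qed simp
  then have V0: "V (Suc n) \<subseteq> V 0" .
  let ?A = "dyadic_add V n k" and ?A' = "dyadic_add V n (Suc k)" and ?V = "V (Suc n)"
  have "k < 2 ^ n" using Suc.prems by (simp add: k_def)
  from Suc.IH[OF this] have A: "?A \<subseteq> V 0" "set_add ?A (V n) \<subseteq> ?A'" "?A' \<subseteq> V 0" by auto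
  have AV: "set_add ?A ?V \<subseteq> ?A'"
    using A(2) set_add_mono[of ?A ?A, OF _ VS] by blast
  show ?case
  proof (cases "even m")
    case True
    then have m: "m = 2 * k" by (simp add: k_def)
    have eq: "dyadic_add V (Suc n) m = ?A" "dyadic_add V (Suc n) (Suc m) = set_add ?A ?V"
      by (simp_all add: m)
    show ?thesis unfolding eq using A AV by (meson order_refl order_trans)
  next
    case False
    then have m: "m = Suc (2 * k)" by (simp add: k_def)
    have eq: "dyadic_add V (Suc n) m = set_add ?A ?V" "dyadic_add V (Suc n) (Suc m) = ?A'"
      by (simp_all add: m)
    have "set_add (set_add ?A ?V) ?V \<subseteq> set_add ?A (set_add ?V ?V)"
    proof (rule set_add_assoc_subset)
      show "gyr b d ` ?V \<subseteq> ?V" if "b \<in> ?V" "d \<in> set_add ?A ?V" for b d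
        using that gyr V0 AV A(3) by blast
    qed (use A(1) V(1) in blast)+
    also have "\<dots> \<subseteq> set_add ?A (V n)" by (rule set_add_mono) (use V(3) in auto)
    finally show ?thesis unfolding eq using A AV by (meson order_trans)
  qed
qed

end

section \<open>Continuity of translations and the separating function at the identity\<close>

context paratopological_gyrogroup
begin

lemma continuous_add_left:
  assumes "a \<in> topspace X"
  shows "continuous_map X X (\<lambda>x. a \<oplus> x)"
  using continuous_map_compose[OF _ continuous_add, of X "\<lambda>x. (a, x)"] assms
  by (simp add: continuous_map_pairwise o_def)

lemma continuous_add_right:
  assumes "a \<in> topspace X"
  shows "continuous_map X X (\<lambda>x. x \<oplus> a)"
  using continuous_map_compose[OF _ continuous_add, of X "\<lambda>x. (x, a)"] assms
  by (simp add: continuous_map_pairwise o_def)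

text \<open>The image of \<open>V\<close> under left translation by \<open>a\<close> is its preimage
  under the continuous left translation by an inverse of \<open>a\<close>; the set sum is the union
  of these images.\<close>

lemma openin_set_add:
  assumes A: "A \<subseteq> topspace X" and V: "openin X V"
  shows "openin X (set_add A V)"
proof -
  have "openin X ((\<lambda>v. a \<oplus> v) ` V)" if "a \<in> A" for a
  proof -
    have a: "a \<in> topspace X" using that A by blast
    obtain a' where a': "a' \<in> topspace X" "a' \<oplus> a = e" "a \<oplus> a' = e"
      using ex_inverse a by blast
    have "(\<lambda>v. a \<oplus> v) ` V = {x \<in> topspace X. a' \<oplus> x \<in> V}"
    proof (intro equalityI subsetI)
      fix x assume "x \<in> (\<lambda>v. a \<oplus> v) ` V"
      then show "x \<in> {x \<in> topspace X. a' \<oplus> x \<in> V}"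
        using openin_subset[OF V] add_inverse_cancel[OF a a'(1,2)] add_closed[OF a] by auto
    next
      fix x assume "x \<in> {x \<in> topspace X. a' \<oplus> x \<in> V}"
      then show "x \<in> (\<lambda>v. a \<oplus> v) ` V"
        using add_inverse_cancel[OF a'(1) a a'(3)] by (metis (lifting) image_eqI mem_Collect_eq)
    qed
    then show ?thesis
      using openin_continuous_map_preimage[OF continuous_add_left[OF a'(1)] V] by simp
  qed
  moreover have "set_add A V = (\<Union>a\<in>A. (\<lambda>v. a \<oplus> v) ` V)" by (auto simp: set_add_def)
  ultimately show ?thesis by auto
qed

lemma set_add_closure_of_subset:
  assumes V: "V \<subseteq> topspace X"
  shows "set_add (X closure_of A) V \<subseteq> X closure_of (set_add A V)"
proof -
  have "x \<oplus> v \<in> X closure_of (set_add A V)" if "x \<in> X closure_of A" "v \<in> V" for x v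
  proof -
    have "continuous_map X X (\<lambda>x. x \<oplus> v)" using continuous_add_right V that(2) by blast
    from continuous_map_image_closure_subset[OF this, of A]
    have "x \<oplus> v \<in> X closure_of ((\<lambda>x. x \<oplus> v) ` A)" using that(1) by blast
    also have "\<dots> \<subseteq> X closure_of (set_add A V)"
      by (rule closure_of_mono) (use that(2) in \<open>auto simp: set_add_def\<close>)
    finally show ?thesis .
  qed
  then show ?thesis by (auto simp: set_add_def)
qed

lemma obtain_half_neighbourhood:
  assumes "openin X W" "e \<in> W"
  obtains N where "openin X N" "e \<in> N" "set_add N N \<subseteq> W"
proof -
  let ?S = "{p \<in> topspace (prod_topology X X). (case p of (x, y) \<Rightarrow> x \<oplus> y) \<in> W}"
  have "openin (prod_topology X X) ?S"
    by (rule openin_continuous_map_preimage[OF continuous_add assms(1)])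
  moreover have "(e, e) \<in> ?S" using assms(2) e_closed by (simp add: add_e_left)
  ultimately obtain A B where AB: "openin X A" "openin X B" "e \<in> A" "e \<in> B" "A \<times> B \<subseteq> ?S"
    unfolding openin_prod_topology_alt by meson
  show thesis
  proof (rule that)
    show "openin X (A \<inter> B)" "e \<in> A \<inter> B" using AB by auto
    show "set_add (A \<inter> B) (A \<inter> B) \<subseteq> W" using AB(5) by (auto simp: set_add_def)
  qed
qed

lemma Urysohn_function_at_identity:
  assumes inv: "locally_gyroscopic_invariant X e gyr"
    and P: "openin X P" "e \<in> P"
  obtains f where "continuous_map X (top_of_set {0..1::real}) f" "f e = 0"
    "\<And>x. x \<notin> X closure_of P \<Longrightarrow> f x = 1"
proof -
  obtain \<B> U where B: "local_base_at X e \<B>" and U: "openin X U" "e \<in> U"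
    and gyrU: "\<forall>V\<in>\<B>. \<forall>a\<in>U. \<forall>b\<in>U. gyr a b ` V \<subseteq> V"
    using inv unfolding locally_gyroscopic_invariant_def by (elim exE conjE)
  have Bo: "\<And>V. V \<in> \<B> \<Longrightarrow> openin X V \<and> e \<in> V"
    and Bex: "\<And>W. \<lbrakk>openin X W; e \<in> W\<rbrakk> \<Longrightarrow> \<exists>V\<in>\<B>. V \<subseteq> W"
    using B unfolding local_base_at_def by blast+
  \<comment> \<open>Starting inside \<open>U\<close> makes every \<open>V n\<close> invariant under
    gyrations with arguments in \<open>V 0\<close>; starting inside \<open>P\<close> bounds the
    whole family by \<open>P\<close>. Only the initial set needs these inclusions, hence the
    condition at \<open>n = 0\<close>.\<close>
  have "\<exists>V. \<forall>n. (V n \<in> \<B> \<and> (n = 0 \<longrightarrow> V n \<subseteq> P \<inter> U)) \<and> set_add (V (Suc n)) (V (Suc n)) \<subseteq> V n"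
  proof (rule dependent_nat_choice)
    show "\<exists>V. V \<in> \<B> \<and> (0 = (0::nat) \<longrightarrow> V \<subseteq> P \<inter> U)"
      using Bex[of "P \<inter> U"] P U by auto
  next
    fix W n assume "W \<in> \<B> \<and> (n = (0::nat) \<longrightarrow> W \<subseteq> P \<inter> U)"
    then obtain N where "openin X N" "e \<in> N" "set_add N N \<subseteq> W"
      using obtain_half_neighbourhood Bo by blast
    moreover from this obtain V where "V \<in> \<B>" "V \<subseteq> N" using Bex by blast
    ultimately show "\<exists>V. (V \<in> \<B> \<and> (Suc n = 0 \<longrightarrow> V \<subseteq> P \<inter> U)) \<and> set_add V V \<subseteq> W"
      using set_add_mono by blast
  qed
  then obtain V where VB: "\<And>n. V n \<in> \<B>" and V0: "V 0 \<subseteq> P \<inter> U"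
    and half: "\<And>n. set_add (V (Suc n)) (V (Suc n)) \<subseteq> V n"
    by metis
  have Vo: "\<And>n. openin X (V n)" and Ve: "\<And>n. e \<in> V n" using VB Bo by blast+
  have Vsub: "\<And>n. V n \<subseteq> topspace X" using Vo openin_subset by blast
  let ?W = "dyadic_add V"
  have W: "?W n m \<subseteq> V 0" "set_add (?W n m) (V n) \<subseteq> ?W n (Suc m)" if "m < 2 ^ n" for n m
  proof -
    have "gyr a b ` V n \<subseteq> V n" if "a \<in> V 0" "b \<in> V 0" for n a b
      using gyrU[rule_format, OF VB, of a b n] that V0 by blast
    from dyadic_add_step[of V, OF Vsub Ve half this that]
    show "?W n m \<subseteq> V 0" "set_add (?W n m) (V n) \<subseteq> ?W n (Suc m)" by simp_all
  qed
  obtain f where f: "continuous_map X (top_of_set {0..1::real}) f"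
    "\<And>x. x \<in> X closure_of ?W 0 0 \<Longrightarrow> f x = 0" "\<And>x. x \<notin> X closure_of ?W 0 1 \<Longrightarrow> f x = 1"
  proof (rule Urysohn_function_of_dyadic_family)
    show "?W (Suc n) (2 * m) = ?W n m" for n m by simp
    show "?W n m \<subseteq> ?W n (Suc m)" if "m < 2 ^ n" for n m
      using subset_set_add[OF _ Ve, of "?W n m" n] W[OF that] Vsub by blast
    show "\<exists>N. openin X N \<and> X closure_of ?W n m \<subseteq> N \<and> N \<subseteq> X closure_of ?W n (Suc m)"
      if "m < 2 ^ n" for n m
    \<comment> \<open>The interposed open set is the closure enlarged by \<open>V n\<close>: left
      translations make it open, right translations keep it in the closure of the enlarged
      set.\<close>
    proof (intro exI conjI)
      show "openin X (set_add (X closure_of ?W n m) (V n))"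
        by (rule openin_set_add[OF closure_of_subset_topspace Vo])
      show "X closure_of ?W n m \<subseteq> set_add (X closure_of ?W n m) (V n)"
        by (rule subset_set_add[OF closure_of_subset_topspace Ve])
      show "set_add (X closure_of ?W n m) (V n) \<subseteq> X closure_of ?W n (Suc m)"
        using set_add_closure_of_subset[OF Vsub] closure_of_mono[OF W(2)[OF that]] by blast
    qed
  qed (rule that)
  show thesis
  proof (rule that[OF f(1)])
    show "f e = 0"
      using f(2) closure_of_subset[of "{e}" X] e_closed by simp
    show "f x = 1" if "x \<notin> X closure_of P" for x
      using f(3)[of x] that closure_of_mono[of "V 0" P X] V0 by auto
  qed
qed

end

section \<open>Transport from the identity to an arbitrary point\<close>

theorem theorem3p2:
  fixes X :: "'a topology"
    and add :: "'a \<Rightarrow> 'a \<Rightarrow> 'a"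
    and e :: 'a
    and gyr :: "'a \<Rightarrow> 'a \<Rightarrow> 'a \<Rightarrow> 'a"
  assumes "paratopological_gyrogroup X add e gyr"
    and "locally_gyroscopic_invariant X e gyr"
    and "regular_space X"
  shows "completely_regular_space X"
proof -
  interpret paratopological_gyrogroup X add e gyr by (rule assms(1))
  show ?thesis
    unfolding completely_regular_space_def
  proof (intro allI impI, elim conjE)
    fix S x assume S: "closedin X S" and "x \<in> topspace X - S"
    then have x: "x \<in> topspace X" "x \<notin> S" by auto
    obtain x' where x': "x' \<in> topspace X" "add x' x = e" "add x x' = e"
      using ex_inverse x by blast
    \<comment> \<open>Left translation by \<open>x\<close> carries \<open>e\<close> to
      \<open>x\<close>, so \<open>T\<close> is the closed set to be separated from \<open>e\<close>.
      Regularity gives \<open>P\<close> with closure disjoint from \<open>T\<close>; composing the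
      function for \<open>P\<close> with translation by \<open>x'\<close> moves the separation back
      to \<open>x\<close> and \<open>S\<close>.\<close>
    define T where "T = {y \<in> topspace X. add x y \<in> S}"
    have "closedin X T"
      unfolding T_def by (rule closedin_continuous_map_preimage[OF continuous_add_left[OF x(1)] S])
    moreover have "e \<in> topspace X - T"
      using x by (simp add: T_def e_closed add_e_right)
    ultimately obtain P where P: "openin X P" "e \<in> P" and clP: "disjnt T (X closure_of P)"
      using assms(3) unfolding regular_space by meson
    obtain f where f: "continuous_map X (top_of_set {0..1::real}) f" "f e = 0"
      "\<And>y. y \<notin> X closure_of P \<Longrightarrow> f y = 1"
      using Urysohn_function_at_identity[OF assms(2) P] by blast
    show "\<exists>f. continuous_map X (top_of_set {0..1::real}) f \<and> f x = 0 \<and> f ` S \<subseteq> {1}"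
    proof (intro exI conjI)
      show "continuous_map X (top_of_set {0..1}) (f \<circ> add x')"
        by (rule continuous_map_compose[OF _ f(1)]) (use continuous_add_left[OF x'(1)] in simp)
      show "(f \<circ> add x') x = 0" using f(2) x'(2) by simp
      have "add x' s \<in> T" if "s \<in> S" for s
        using that closedin_subset[OF S] x' add_inverse_cancel[OF x'(1) x(1) x'(3), of s]
        by (auto simp: T_def add_closed)
      then show "(f \<circ> add x') ` S \<subseteq> {1}" using f(3) clP by (auto simp: disjnt_iff)
    qed
  qed
qed

end
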